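(* Let $n\in\mathbb{N}$, $N=n^2$, and let $P\subset\mathbb{R}^2$ be a set of $N$ pairwise distinct points. Suppose a bijective placement of $P$ into the $n\times n$ grid is in a stable state and that this stable state is unique (no other bijective placement of $P$ into the grid is in a stable state). Then the placement satisfies both the $x$-bin condition and the $y$-bin condition.
   Context: Write $p=(p_1,p_2)$. Define $p\prec_x q$ iff $p_1<q_1$, or $p_1=q_1$ and $p_2<q_2$; and $p\prec_y q$ iff $p_2<q_2$, or $p_2=q_2$ and $p_1<q_1$. The grid has columns $1,\ldots,n$ from left to right and rows $1,\ldots,n$ from bottom to top, each cell containing one point. A placement is a stable state iff within every row the points increase in $\prec_x$ from left to right and within every column the points increase in $\prec_y$ from bottom to top. List $P$ in $\prec_x$-increasing order as $q_1,\ldots,q_N$ and in $\prec_y$-increasing order as $s_1,\ldots,s_N$. The placement satisfies the $x$-bin condition iff for every $k\in[n]$ column $k$ contains exactly the points $q_{(k-1)n+1},\ldots,q_{kn}$; it satisfies the $y$-bin condition iff for every $\ell\in[n]$ row $\ell$ contains exactly the points $s_{(\ell-1)n+1},\ldots,s_{\ell n}$. *)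

theory Defs
  imports Complex_Main
begin

definition prec_x :: "real \<times> real \<Rightarrow> real \<times> real \<Rightarrow> bool" where
  "prec_x p q \<longleftrightarrow> fst p < fst q \<or> fst p = fst q \<and> snd p < snd q"

definition prec_y :: "real \<times> real \<Rightarrow> real \<times> real \<Rightarrow> bool" where
  "prec_y p q \<longleftrightarrow> snd p < snd q \<or> snd p = snd q \<and> fst p < fst q"

text \<open>A cell is a pair (column, row). Columns are numbered from left to right and rows from
  bottom to top, both starting at 1.\<close>

definition grid :: "nat \<Rightarrow> (nat \<times> nat) set" where
  "grid n = {1..n} \<times> {1..n}"

text \<open>Only the values on the grid are meaningful, so placements are to be compared there.\<close>

definition placement :: "nat \<Rightarrow> (real \<times> real) set \<Rightarrow> (nat \<times> nat \<Rightarrow> real \<times> real) \<Rightarrow> bool" where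
  "placement n P g \<longleftrightarrow> bij_betw g (grid n) P"

definition stable_state :: "nat \<Rightarrow> (nat \<times> nat \<Rightarrow> real \<times> real) \<Rightarrow> bool" where
  "stable_state n g \<longleftrightarrow>
     (\<forall>r\<in>{1..n}. \<forall>c\<in>{1..n}. \<forall>c'\<in>{1..n}. c < c' \<longrightarrow> prec_x (g (c, r)) (g (c', r))) \<and>
     (\<forall>c\<in>{1..n}. \<forall>r\<in>{1..n}. \<forall>r'\<in>{1..n}. r < r' \<longrightarrow> prec_y (g (c, r)) (g (c, r')))"

definition increasing_list :: "('a \<Rightarrow> 'a \<Rightarrow> bool) \<Rightarrow> 'a set \<Rightarrow> 'a list" where
  "increasing_list prec P = (THE xs. sorted_wrt prec xs \<and> set xs = P)"

text \<open>The description is proper for a finite set and a strict total order, in particular for the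
  two orders above.\<close>

lemma (in linorder) ex1_increasing_list:
  assumes "finite P"
  shows "\<exists>!xs. sorted_wrt (<) xs \<and> set xs = P"
  using finite_sorted_distinct_unique[OF assms] by (auto simp: strict_sorted_iff)

lemma linorder_prec_x: "class.linorder (\<lambda>p q. p = q \<or> prec_x p q) prec_x"
  by unfold_locales (auto simp: prec_x_def prod_eq_iff)

lemma linorder_prec_y: "class.linorder (\<lambda>p q. p = q \<or> prec_y p q) prec_y"
  by unfold_locales (auto simp: prec_y_def prod_eq_iff)

lemma increasing_list_prec_x:
  assumes "finite P"
  shows "sorted_wrt prec_x (increasing_list prec_x P)" "set (increasing_list prec_x P) = P"
  using theI'[OF linorder.ex1_increasing_list[OF linorder_prec_x assms]]
  by (simp_all add: increasing_list_def)

lemma increasing_list_prec_y: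
  assumes "finite P"
  shows "sorted_wrt prec_y (increasing_list prec_y P)" "set (increasing_list prec_y P) = P"
  using theI'[OF linorder.ex1_increasing_list[OF linorder_prec_y assms]]
  by (simp_all add: increasing_list_def)

text \<open>Lists are indexed from 0, so the \<open>i\<close>-th point of the enumeration is entry \<open>i - 1\<close>.\<close>

definition x_bin :: "nat \<Rightarrow> (real \<times> real) set \<Rightarrow> (nat \<times> nat \<Rightarrow> real \<times> real) \<Rightarrow> bool" where
  "x_bin n P g \<longleftrightarrow>
     (\<forall>k\<in>{1..n}. {g (k, r) | r. r \<in> {1..n}} =
        {increasing_list prec_x P ! (i - 1) | i. i \<in> {(k - 1) * n + 1..k * n}})"

definition y_bin :: "nat \<Rightarrow> (real \<times> real) set \<Rightarrow> (nat \<times> nat \<Rightarrow> real \<times> real) \<Rightarrow> bool" where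
  "y_bin n P g \<longleftrightarrow>
     (\<forall>l\<in>{1..n}. {g (c, l) | c. c \<in> {1..n}} =
        {increasing_list prec_y P ! (i - 1) | i. i \<in> {(l - 1) * n + 1..l * n}})"

end

theory Submission
  imports Defs
begin

text \<open>Cutting the \<open>x\<close>-increasing list into \<open>n\<close> consecutive blocks, one per column, and sorting every
  column by \<open>\<prec>\<^sub>y\<close> gives a stable state: rows increase because all of column \<open>k\<close> precedes all of
  column \<open>k + 1\<close>. Exchanging the roles of the axes gives a second stable state, filled by rows. By
  uniqueness both coincide with the given placement, which therefore has both bin properties.\<close>

text \<open>Stated for an abstract strict linear order so that it serves both axes at once. The
  length is the cardinality because strict sortedness excludes repetitions.\<close>

lemma increasing_list_linorder:
  assumes "class.linorder le prec" and "finite P"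
  shows "sorted_wrt prec (increasing_list prec P)" "set (increasing_list prec P) = P"
    "length (increasing_list prec P) = card P"
proof -
  let ?xs = "increasing_list prec P"
  interpret linorder le prec by fact
  have *: "sorted_wrt prec ?xs \<and> set ?xs = P"
    using theI'[OF ex1_increasing_list[OF assms(2)]] by (simp add: increasing_list_def)
  then show "sorted_wrt prec ?xs" "set ?xs = P" by auto
  have "distinct ?xs" using * strict_sorted_iff by blast
  then show "length ?xs = card P" using * distinct_card by fastforce
qed

text \<open>\<open>R\<close> cuts \<open>P\<close> into blocks and \<open>S\<close> sorts inside
  each block. Keeping both orders abstract allows two uses: with \<open>prec_x\<close> as
  \<open>R\<close> blocks are columns, with \<open>prec_y\<close> as \<open>R\<close> they are
  rows.\<close>

lemma block_placement:
  fixes R S :: "'a \<Rightarrow> 'a \<Rightarrow> bool"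
  assumes R: "class.linorder leR R" and S: "class.linorder leS S"
    and P: "finite P" "card P = n\<^sup>2"
  obtains h where "bij_betw h (grid n) P"
    and "\<And>k k' r r'. k \<in> {1..n} \<Longrightarrow> k' \<in> {1..n} \<Longrightarrow> r \<in> {1..n} \<Longrightarrow> r' \<in> {1..n} \<Longrightarrow> k < k' \<Longrightarrow>
      R (h (k, r)) (h (k', r'))"
    and "\<And>k r r'. k \<in> {1..n} \<Longrightarrow> r \<in> {1..n} \<Longrightarrow> r' \<in> {1..n} \<Longrightarrow> r < r' \<Longrightarrow> S (h (k, r)) (h (k, r'))"
    and "\<And>k. k \<in> {1..n} \<Longrightarrow> {h (k, r) | r. r \<in> {1..n}} =
      {increasing_list R P ! (i - 1) | i. i \<in> {(k - 1) * n + 1..k * n}}"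
proof -
  interpret R: linorder leR R by fact
  interpret S: linorder leS S by fact
  define xs where "xs = increasing_list R P"
  have xs: "sorted_wrt R xs" "set xs = P" "length xs = n * n"
    using increasing_list_linorder[OF R P(1)] P(2) by (simp_all add: xs_def power2_eq_square)
  have dist: "distinct xs" using xs(1) R.strict_sorted_iff by blast
  define B where "B k = {xs ! (i - 1) | i. i \<in> {(k - 1) * n + 1..k * n}}" for k
  define h where "h = (\<lambda>(k, r). increasing_list S (B k) ! (r - 1))"
  have B_image: "B k = (\<lambda>i. xs ! (i - 1)) ` {(k - 1) * n + 1..k * n}" for k
    by (auto simp: B_def)
  have le: "k * n \<le> n * n" if "k \<in> {1..n}" for k using that by simp
  have card_B: "card (B k) = n" if k: "k \<in> {1..n}" for k
  proof -
    have "inj_on (\<lambda>i. xs ! (i - 1)) {(k - 1) * n + 1..k * n}"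
    proof (rule inj_onI)
      fix i j
      assume ij: "i \<in> {(k - 1) * n + 1..k * n}" "j \<in> {(k - 1) * n + 1..k * n}"
        and eq: "xs ! (i - 1) = xs ! (j - 1)"
      \<comment> \<open>Subtraction on \<open>nat\<close> truncates, so the lower bounds are what
        lets \<open>i - 1 = j - 1\<close> give \<open>i = j\<close>.\<close>
      have "1 \<le> i" "1 \<le> j" "i - 1 < length xs" "j - 1 < length xs"
        using ij le[OF k] xs(3) unfolding atLeastAtMost_iff by linarith+
      then show "i = j" using eq dist by (simp add: nth_eq_iff_index_eq)
    qed
    then have "card (B k) = k * n - (k - 1) * n"
      unfolding B_image by (subst card_image) auto
    also have "\<dots> = n" using k by (simp flip: diff_mult_distrib)
    finally show ?thesis .
  qed
  have fin: "finite (B k)" for k by (simp add: B_image)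
  have B_P: "B k \<subseteq> P" if k: "k \<in> {1..n}" for k
  proof -
    have "i - 1 < length xs" if "i \<in> {(k - 1) * n + 1..k * n}" for i
      using that le[OF k] xs(3) unfolding atLeastAtMost_iff by linarith
    then show ?thesis unfolding B_image xs(2)[symmetric] by (intro image_subsetI nth_mem)
  qed
  note ys = increasing_list_linorder[OF S fin]
  have bin: "{h (k, r) | r. r \<in> {1..n}} = B k" if k: "k \<in> {1..n}" for k
  proof -
    \<comment> \<open>The sorted block has exactly \<open>n\<close> entries, at positions
      \<open>0\<close> to \<open>n - 1\<close>; \<open>Suc\<close> shifts these to the second
      coordinates \<open>1\<close> to \<open>n\<close>.\<close>
    have "B k = (!) (increasing_list S (B k)) ` {..<n}"
      using ys(2)[of k, symmetric] ys(3)[of k] card_B[OF k] by (auto simp: set_conv_nth)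
    also have "\<dots> = (\<lambda>r. h (k, r)) ` Suc ` {..<n}"
      by (simp add: h_def image_image)
    also have "\<dots> = {h (k, r) | r. r \<in> {1..n}}"
      unfolding image_Suc_lessThan by blast
    finally show ?thesis by simp
  qed
  have mem: "h (k, r) \<in> B k" if "k \<in> {1..n}" "r \<in> {1..n}" for k r
    using bin that by blast
  have hR: "R (h (k, r)) (h (k', r'))"
    if m: "k \<in> {1..n}" "k' \<in> {1..n}" "r \<in> {1..n}" "r' \<in> {1..n}" "k < k'" for k k' r r'
  proof -
    \<comment> \<open>Sorting by \<open>S\<close> loses the position within the block, but the index
      ranges of different blocks are disjoint and ordered, which suffices.\<close>
    obtain i j where i: "h (k, r) = xs ! (i - 1)" "(k - 1) * n + 1 \<le> i" "i \<le> k * n"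
      and j: "h (k', r') = xs ! (j - 1)" "(k' - 1) * n + 1 \<le> j" "j \<le> k' * n"
      using mem[OF m(1,3)] mem[OF m(2,4)] unfolding B_def mem_Collect_eq atLeastAtMost_iff
      by blast
    have "k * n \<le> (k' - 1) * n" using \<open>k < k'\<close> by (intro mult_right_mono) auto
    then have "i - 1 < j - 1" "j - 1 < length xs"
      using i j le[OF m(2)] xs(3) by linarith+
    then show ?thesis using i j xs(1) sorted_wrt_nth_less by metis
  qed
  have hS: "S (h (k, r)) (h (k, r'))"
    if "k \<in> {1..n}" "r \<in> {1..n}" "r' \<in> {1..n}" "r < r'" for k r r'
    using that ys(3)[of k] card_B by (auto simp: h_def intro!: sorted_wrt_nth_less[OF ys(1)])
  have inj: "inj_on h (grid n)"
  proof (rule inj_onI, clarify)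
    fix k r k' r'
    assume "(k, r) \<in> grid n" "(k', r') \<in> grid n" and eq: "h (k, r) = h (k', r')"
    then have m: "k \<in> {1..n}" "k' \<in> {1..n}" "r \<in> {1..n}" "r' \<in> {1..n}" by (auto simp: grid_def)
    \<comment> \<open>Different blocks are separated by \<open>R\<close>, different entries of one
      block by \<open>S\<close>; irreflexivity then excludes equal values.\<close>
    have "k = k'" using hR m eq R.less_irrefl by (metis linorder_neqE_nat)
    moreover from this have "r = r'" using hS m eq S.less_irrefl by (metis linorder_neqE_nat)
    ultimately show "k = k' \<and> r = r'" by simp
  qed
  have "h ` grid n \<subseteq> P" using mem B_P by (fastforce simp: grid_def)
  \<comment> \<open>Surjectivity by counting: the image is a subset of the finite set
    \<open>P\<close> with as many elements.\<close>
  moreover have "card (h ` grid n) = card P"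
    unfolding card_image[OF inj] using P(2) by (simp add: grid_def power2_eq_square)
  ultimately have "bij_betw h (grid n) P"
    using inj P(1) by (simp add: bij_betw_def card_subset_eq)
  then show thesis using that hR hS bin unfolding B_def xs_def by blast
qed

theorem theorem3:
  fixes n N :: nat
    and P :: "(real \<times> real) set"
    and g :: "nat \<times> nat \<Rightarrow> real \<times> real"
  assumes "N = n^2"
    and "finite P" and "card P = N"
    and "placement n P g" and "stable_state n g"
    and "\<And>h. placement n P h \<Longrightarrow> stable_state n h \<Longrightarrow> (\<forall>z\<in>grid n. h z = g z)"
  shows "x_bin n P g \<and> y_bin n P g"
proof
  have card: "card P = n\<^sup>2" using assms by simp
  show "x_bin n P g"
  proof (rule block_placement[OF linorder_prec_x linorder_prec_y assms(2) card])
    fix h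
    assume bij: "bij_betw h (grid n) P"
      and row: "\<And>k k' r r'. k \<in> {1..n} \<Longrightarrow> k' \<in> {1..n} \<Longrightarrow> r \<in> {1..n} \<Longrightarrow> r' \<in> {1..n} \<Longrightarrow> k < k' \<Longrightarrow>
        prec_x (h (k, r)) (h (k', r'))"
      and col: "\<And>k r r'. k \<in> {1..n} \<Longrightarrow> r \<in> {1..n} \<Longrightarrow> r' \<in> {1..n} \<Longrightarrow> r < r' \<Longrightarrow>
        prec_y (h (k, r)) (h (k, r'))"
      and bin: "\<And>k. k \<in> {1..n} \<Longrightarrow> {h (k, r) | r. r \<in> {1..n}} =
        {increasing_list prec_x P ! (i - 1) | i. i \<in> {(k - 1) * n + 1..k * n}}"
    have "stable_state n h" unfolding stable_state_def using row col by blast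
    then have "\<forall>z\<in>grid n. h z = g z" using assms(6) bij by (simp add: placement_def)
    \<comment> \<open>Uniqueness gives agreement on the grid only, which covers every cell of column
      \<open>k\<close>.\<close>
    then have "{g (k, r) | r. r \<in> {1..n}} = {h (k, r) | r. r \<in> {1..n}}" if "k \<in> {1..n}" for k
      using that unfolding grid_def by (metis (no_types, lifting) SigmaI)
    then show ?thesis using bin by (simp add: x_bin_def)
  qed
  show "y_bin n P g"
  proof (rule block_placement[OF linorder_prec_y linorder_prec_x assms(2) card])
    fix h
    assume bij: "bij_betw h (grid n) P"
      and col: "\<And>k k' r r'. k \<in> {1..n} \<Longrightarrow> k' \<in> {1..n} \<Longrightarrow> r \<in> {1..n} \<Longrightarrow> r' \<in> {1..n} \<Longrightarrow> k < k' \<Longrightarrow>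
        prec_y (h (k, r)) (h (k', r'))"
      and row: "\<And>k r r'. k \<in> {1..n} \<Longrightarrow> r \<in> {1..n} \<Longrightarrow> r' \<in> {1..n} \<Longrightarrow> r < r' \<Longrightarrow>
        prec_x (h (k, r)) (h (k, r'))"
      and bin: "\<And>k. k \<in> {1..n} \<Longrightarrow> {h (k, r) | r. r \<in> {1..n}} =
        {increasing_list prec_y P ! (i - 1) | i. i \<in> {(k - 1) * n + 1..k * n}}"
    \<comment> \<open>Here blocks are rows, so \<open>h\<close> takes (row, column); swapping the
      coordinates restores the cell convention (column, row).\<close>
    have "bij_betw prod.swap (grid n) (grid n)"
      by (auto simp: bij_betw_def grid_def)
    then have "placement n P (h \<circ> prod.swap)"
      unfolding placement_def using bij by (rule bij_betw_trans)
    \<comment> \<open>Rows increase by the sorting inside blocks, columns by the order between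
      blocks.\<close>
    moreover have "stable_state n (h \<circ> prod.swap)" using row col by (simp add: stable_state_def)
    ultimately have "\<forall>z\<in>grid n. (h \<circ> prod.swap) z = g z" by (rule assms(6))
    then have "g (c, l) = h (l, c)" if "c \<in> {1..n}" "l \<in> {1..n}" for c l
      using that by (simp add: grid_def)
    then have "{g (c, l) | c. c \<in> {1..n}} = {h (l, c) | c. c \<in> {1..n}}" if "l \<in> {1..n}" for l
      using that by (metis (no_types, lifting))
    then show ?thesis using bin by (simp add: y_bin_def)
  qed
qed

end
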